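(* Let $X$ be a connected bipartite vertex-transitive graph of order $n$ that is regular of degree $d$. Let $V(X)=V_1\cup V_2$ be the bipartition of the vertex set, and let $G\le\mathrm{Aut}(X)$ be a subgroup acting transitively on $V(X)$. Suppose there exists a block $B\subset V(X)$ for the action of $G$ such that $|B|=\frac{n}{2d}$ and $B\subseteq V_1$, and there is a vertex $v\in B$ such that $N(v)\cap B^g$ is nonempty for exactly $d$ different blocks $B^g$, $g\in G$. Then $X$ is a $d$-RDR graph. Moreover, if such a block exists, it is an orbit of a subgroup $H\le G$ whose order satisfies $|H|\equiv 0\pmod{\frac{n}{2d}}$ and which contains the vertex-stabilizer $G_v$.
   Context: All graphs are finite and simple. For a graph $G=(V,E)$, $N(v)$ is the open neighbourhood of $v$. Let $\mathcal K=\{1,\dots,k\}$. A $k$-rainbow dominating function ($k$-RDF) on a graph is a map $f\colon V\to 2^{\mathcal K}$ such that $f(v)=\emptyset$ implies $\bigcup_{u\in N(v)}f(u)=\mathcal K$, for all $v\in V$. Its weight is $\sum_{v\in V}|f(v)|$, and $\gamma_{rk}$ denotes the minimum weight of a $k$-RDF on the graph. It is known that a $d$-regular graph of order $n$ satisfies $\gamma_{rd}\ge n/2$; it is called $d$-rainbow domination regular ($d$-RDR) if $\gamma_{rd}=n/2$. A graph is vertex-transitive if its automorphism group acts transitively on its vertices. For $g\in G$, $B^g$ denotes the image of $B$ under $g$. A block for the action of a transitive group $G$ is a nonempty subset $B$ such that for every $g\in G$ either $B^g=B$ or $B^g\cap B=\emptyset$. *)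

theory Defs
  imports
    "Graph_Theory.Digraph_Component"
    "Graph_Theory.Pair_Digraph"
    "HOL-Algebra.Group_Action"
    "HOL-Number_Theory.Cong"
begin

text \<open>
  Finite simple graphs are those satisfying the locale predicate \<^locale>\<open>pair_graph\<close>: finite,
  loop-free, symmetric digraphs whose arcs are pairs of vertices.
\<close>

definition neighbourhood :: "'a pair_pre_digraph \<Rightarrow> 'a \<Rightarrow> 'a set" where
  "neighbourhood X v = {u \<in> pverts X. (v, u) \<in> parcs X}"

definition regular_graph :: "nat \<Rightarrow> 'a pair_pre_digraph \<Rightarrow> bool" where
  "regular_graph d X \<longleftrightarrow> (\<forall>v\<in>pverts X. card (neighbourhood X v) = d)"

definition bipartition :: "'a pair_pre_digraph \<Rightarrow> 'a set \<Rightarrow> 'a set \<Rightarrow> bool" where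
  "bipartition X V1 V2 \<longleftrightarrow>
     pverts X = V1 \<union> V2 \<and> V1 \<inter> V2 = {} \<and>
     (\<forall>(u, w)\<in>parcs X. (u \<in> V1 \<and> w \<in> V2) \<or> (u \<in> V2 \<and> w \<in> V1))"


subsection \<open>Rainbow domination\<close>

definition rainbow_dominating :: "nat \<Rightarrow> 'a pair_pre_digraph \<Rightarrow> ('a \<Rightarrow> nat set) \<Rightarrow> bool" where
  "rainbow_dominating k X f \<longleftrightarrow>
     (\<forall>v\<in>pverts X. f v \<subseteq> {1..k}) \<and>
     (\<forall>v\<in>pverts X. f v = {} \<longrightarrow> (\<Union>u\<in>neighbourhood X v. f u) = {1..k})"

definition rainbow_weight :: "'a pair_pre_digraph \<Rightarrow> ('a \<Rightarrow> nat set) \<Rightarrow> nat" where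
  "rainbow_weight X f = (\<Sum>v\<in>pverts X. card (f v))"

text \<open>The minimum exists, since the constant function with value \<open>{1..k}\<close> is admissible.\<close>

definition rainbow_domination_number :: "nat \<Rightarrow> 'a pair_pre_digraph \<Rightarrow> nat" where
  "rainbow_domination_number k X =
     (LEAST w. \<exists>f. rainbow_dominating k X f \<and> rainbow_weight X f = w)"

definition rainbow_domination_regular :: "nat \<Rightarrow> 'a pair_pre_digraph \<Rightarrow> bool" where
  "rainbow_domination_regular d X \<longleftrightarrow>
     regular_graph d X \<and>
     real (rainbow_domination_number d X) = real (card (pverts X)) / 2"


subsection \<open>Automorphisms, vertex-transitivity and blocks\<close>

text \<open>
  As in \<^const>\<open>BijGroup\<close>, permutations of the vertex set are made unique by taking them
  extensional (undefined outside the vertex set).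
\<close>

definition graph_aut :: "'a pair_pre_digraph \<Rightarrow> ('a \<Rightarrow> 'a) set" where
  "graph_aut X = {g \<in> Bij (pverts X).
     \<forall>u\<in>pverts X. \<forall>w\<in>pverts X. (g u, g w) \<in> parcs X \<longleftrightarrow> (u, w) \<in> parcs X}"

definition GraphAutGroup :: "'a pair_pre_digraph \<Rightarrow> ('a \<Rightarrow> 'a) monoid" where
  "GraphAutGroup X = BijGroup (pverts X) \<lparr>carrier := graph_aut X\<rparr>"

definition vertex_transitive :: "'a pair_pre_digraph \<Rightarrow> bool" where
  "vertex_transitive X \<longleftrightarrow> transitive_action (GraphAutGroup X) (pverts X) (\<lambda>g. g)"

definition block ::
  "('g, 'm) monoid_scheme \<Rightarrow> 'b set \<Rightarrow> ('g \<Rightarrow> 'b \<Rightarrow> 'b) \<Rightarrow> 'b set \<Rightarrow> bool" where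
  "block G E \<phi> B \<longleftrightarrow>
     B \<noteq> {} \<and> B \<subseteq> E \<and> (\<forall>g\<in>carrier G. \<phi> g ` B = B \<or> \<phi> g ` B \<inter> B = {})"

lemma subgroup_graph_aut: "subgroup (graph_aut X) (BijGroup (pverts X))"
proof (rule group.subgroupI[OF group_BijGroup])
  show "graph_aut X \<subseteq> carrier (BijGroup (pverts X))"
    by (auto simp: graph_aut_def BijGroup_def)
  have "(\<lambda>x\<in>pverts X. x) \<in> graph_aut X"
    by (auto simp: graph_aut_def id_Bij)
  then show "graph_aut X \<noteq> {}" by blast
next
  fix g assume g: "g \<in> graph_aut X"
  then have gB: "g \<in> Bij (pverts X)" by (simp add: graph_aut_def)
  let ?h = "inv_into (pverts X) g"
  have img: "g ` pverts X = pverts X" using gB by (auto simp: Bij_def bij_betw_def)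
  have h: "?h u \<in> pverts X \<and> g (?h u) = u" if "u \<in> pverts X" for u
    using that img by (metis f_inv_into_f inv_into_into)
  have "(?h u, ?h w) \<in> parcs X \<longleftrightarrow> (u, w) \<in> parcs X"
    if "u \<in> pverts X" "w \<in> pverts X" for u w
    using g h[OF that(1)] h[OF that(2)] unfolding graph_aut_def by fastforce
  then show "inv\<^bsub>BijGroup (pverts X)\<^esub> g \<in> graph_aut X"
    using gB by (simp add: inv_BijGroup graph_aut_def restrict_inv_into_Bij)
next
  fix g h assume "g \<in> graph_aut X" "h \<in> graph_aut X"
  then show "g \<otimes>\<^bsub>BijGroup (pverts X)\<^esub> h \<in> graph_aut X"
    by (auto simp: graph_aut_def BijGroup_def compose_Bij compose_eq dest: Bij_imp_funcset)
qed

lemma group_GraphAutGroup: "group (GraphAutGroup X)"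
  unfolding GraphAutGroup_def
  by (rule subgroup.subgroup_is_group[OF subgroup_graph_aut group_BijGroup])

lemma group_action_GraphAutGroup:
  assumes "subgroup G (GraphAutGroup X)"
  shows "group_action (GraphAutGroup X\<lparr>carrier := G\<rparr>) (pverts X) (\<lambda>g. g)"
proof -
  have "group (GraphAutGroup X\<lparr>carrier := G\<rparr>)"
    by (rule subgroup.subgroup_is_group[OF assms group_GraphAutGroup])
  moreover have "G \<subseteq> Bij (pverts X)"
    using subgroup.subset[OF assms] by (auto simp: GraphAutGroup_def graph_aut_def)
  ultimately show ?thesis
    using group_BijGroup[of "pverts X"]
    by (auto simp: group_action_def group_hom_def group_hom_axioms_def hom_def
        GraphAutGroup_def BijGroup_def)
qed

end

theory Submission
  imports Defs
begin

text \<open>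
  Automorphisms of the connected graph \<open>X\<close> preserve or swap the two sides of the bipartition, so the
  \<open>2 * d\<close> translates of \<open>B\<close> partition each side into \<open>d\<close> blocks. The neighbourhood of \<open>v\<close> lies in the
  side opposite to \<open>B\<close> and meets \<open>d\<close> translates, hence all translates in that side; by transitivity
  the same holds for every vertex in the side of \<open>B\<close>. Giving the \<open>d\<close> blocks in the opposite side
  distinct colours, and no colour to the side of \<open>B\<close>, thus yields a rainbow dominating function of
  weight \<open>n / 2\<close>, which is optimal by double counting. The subgroup \<open>H\<close> is the setwise stabilizer
  of \<open>B\<close>, and the congruence is the orbit-stabilizer theorem.
\<close>

section \<open>Blocks of group actions\<close>

context group_action
begin

lemma image_mult:
  assumes "g \<in> carrier G" "h \<in> carrier G" "S \<subseteq> E"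
  shows "\<phi> (g \<otimes> h) ` S = \<phi> g ` \<phi> h ` S"
  unfolding image_image
  by (rule image_cong) (use assms in \<open>auto simp: composition_rule\<close>)

lemma image_inv_image:
  assumes "g \<in> carrier G" "S \<subseteq> E"
  shows "\<phi> (inv g) ` \<phi> g ` S = S"
proof -
  have "\<phi> (inv g) (\<phi> g x) = x" if "x \<in> S" for x
    using orbit_sym_aux[of g x] assms that by auto
  then show ?thesis by (simp add: image_image)
qed

text \<open>A block is only required to be comparable with its own translates. Two arbitrary
  translates reduce to that case by applying \<open>inv h\<close>: if they meet, then
  \<open>inv h \<otimes> g\<close> moves a point of \<open>B\<close> into \<open>B\<close>, hence
  fixes \<open>B\<close> setwise, and applying \<open>h\<close> again gives the equality.\<close>

lemma block_images_eq_or_disjoint: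
  assumes B: "block G E \<phi> B" and g: "g \<in> carrier G" and h: "h \<in> carrier G"
    and meet: "\<phi> g ` B \<inter> \<phi> h ` B \<noteq> {}"
  shows "\<phi> g ` B = \<phi> h ` B"
proof -
  interpret group G using group_hom group_hom.axioms(1) by auto
  have BE: "B \<subseteq> E" using B by (simp add: block_def)
  obtain a b where ab: "a \<in> B" "b \<in> B" "\<phi> g a = \<phi> h b" using meet by auto
  have "\<phi> (inv h \<otimes> g) a = b"
    using ab subsetD[OF BE] g h composition_rule[of a "inv h" g] orbit_sym_aux[of h b "\<phi> h b"]
    by auto
  then have "\<phi> (inv h \<otimes> g) ` B \<inter> B \<noteq> {}" using ab by blast
  then have "\<phi> (inv h \<otimes> g) ` B = B"
    using B g h unfolding block_def by blast
  moreover have "\<phi> h ` \<phi> (inv h \<otimes> g) ` B = \<phi> g ` B"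
    using image_mult[of h "inv h \<otimes> g" B] g h BE by (simp add: m_assoc[symmetric])
  ultimately show ?thesis by simp
qed

lemma subgroup_setwise_stabilizer:
  assumes "S \<subseteq> E"
  shows "subgroup {g \<in> carrier G. \<phi> g ` S = S} G"
proof -
  interpret group G using group_hom group_hom.axioms(1) by auto
  have "\<phi> \<one> ` S = S"
    using assms id_eq_one[symmetric] by (auto simp: subset_iff image_iff)
  moreover have "\<phi> (inv g) ` S = S" if "g \<in> carrier G" "\<phi> g ` S = S" for g
    using image_inv_image[OF that(1) assms] that(2) by simp
  ultimately show ?thesis
    by (intro subgroupI) (auto simp: image_mult assms)
qed

lemma subgroup_action:
  assumes "subgroup H G"
  shows "group_action (G\<lparr>carrier := H\<rparr>) E \<phi>"
proof -
  interpret group_hom G "BijGroup E" \<phi> by (rule group_hom)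
  have "group (G\<lparr>carrier := H\<rparr>)"
    by (rule subgroup.subgroup_is_group[OF assms]) (rule G.group_axioms)
  then show ?thesis
    using subgroup.subset[OF assms] group_BijGroup[of E]
    by (auto simp: group_action_def group_hom_def group_hom_axioms_def hom_def subset_iff)
qed

text \<open>If g fixes x, then x lies in both \<open>B\<close> and its translate, so the block
  property forces them to be equal.\<close>

lemma stabilizer_subset_setwise_stabilizer:
  assumes "block G E \<phi> B" "x \<in> B"
  shows "stabilizer G \<phi> x \<subseteq> {g \<in> carrier G. \<phi> g ` B = B}"
  using assms unfolding block_def stabilizer_def by force

end

text \<open>Transitivity of the whole group suffices: any g taking x to another point of
  \<open>B\<close> makes the translate meet \<open>B\<close>, so g automatically stabilizes
  \<open>B\<close>.\<close>

lemma (in transitive_action) block_is_orbit: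
  assumes B: "block G E \<phi> B" and x: "x \<in> B"
  shows "orbit (G\<lparr>carrier := {g \<in> carrier G. \<phi> g ` B = B}\<rparr>) \<phi> x = B"
proof
  show "orbit (G\<lparr>carrier := {g \<in> carrier G. \<phi> g ` B = B}\<rparr>) \<phi> x \<subseteq> B"
    using x by (auto simp: orbit_def)
  show "B \<subseteq> orbit (G\<lparr>carrier := {g \<in> carrier G. \<phi> g ` B = B}\<rparr>) \<phi> x"
  proof
    fix b assume b: "b \<in> B"
    then obtain g where g: "g \<in> carrier G" "\<phi> g x = b"
      using B x unique_orbit[of x b] by (auto simp: block_def)
    then have "\<phi> g ` B = B"
      using B x b unfolding block_def by blast
    then show "b \<in> orbit (G\<lparr>carrier := {g \<in> carrier G. \<phi> g ` B = B}\<rparr>) \<phi> x"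
      using g by (auto simp: orbit_def)
  qed
qed

text \<open>Since \<open>B\<close> is an orbit of its setwise stabilizer, the quotient is the order
  of a point stabilizer.\<close>

lemma (in transitive_action) card_block_dvd_card_setwise_stabilizer:
  assumes B: "block G E \<phi> B"
  shows "card B dvd card {g \<in> carrier G. \<phi> g ` B = B}"
proof -
  obtain x where x: "x \<in> B" and BE: "B \<subseteq> E" using B by (auto simp: block_def)
  interpret H: group_action "G\<lparr>carrier := {g \<in> carrier G. \<phi> g ` B = B}\<rparr>" E \<phi>
    by (rule subgroup_action[OF subgroup_setwise_stabilizer[OF BE]])
  show ?thesis
    using H.orbit_stabilizer_theorem[of x] x BE
    unfolding block_is_orbit[OF B x] order_def by (auto intro: dvdI[OF sym])
qed

section \<open>Rainbow domination of regular graphs\<close>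

text \<open>The empty vertices and the coloured ones are each at most as many as the weight. A
  coloured vertex contributes at least 1. An empty vertex sees neighbours of total weight at least
  d, while a vertex is seen by exactly d others; so d times the number of empty vertices is at most
  d times the weight.\<close>

lemma card_pverts_le_double_weight:
  assumes X: "pair_graph X" and reg: "regular_graph d X" and d: "d > 0"
    and f: "rainbow_dominating d X f"
  shows "card (pverts X) \<le> 2 * rainbow_weight X f"
proof -
  interpret pair_graph X by (rule X)
  let ?V = "pverts X"
  let ?Z = "{v \<in> ?V. f v = {}}"
  have fin: "finite ?V" by (rule pair_finite_verts)
  have finf: "finite (f v)" if "v \<in> ?V" for v
    using f that finite_subset by (fastforce simp: rainbow_dominating_def)
  have N: "finite (neighbourhood X v)" "neighbourhood X v \<subseteq> ?V" for v
    using fin by (auto simp: neighbourhood_def)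
  have sym: "u \<in> neighbourhood X v \<longleftrightarrow> v \<in> neighbourhood X u" if "u \<in> ?V" "v \<in> ?V" for u v
    using pair_sym_arcs that
    by (auto simp: neighbourhood_def symmetric_def elim: symE)
  have "d \<le> (\<Sum>u\<in>neighbourhood X v. card (f u))" if "v \<in> ?Z" for v
  proof -
    have "d = card (\<Union>u\<in>neighbourhood X v. f u)"
      using f that by (auto simp: rainbow_dominating_def)
    also have "\<dots> \<le> (\<Sum>u\<in>neighbourhood X v. card (f u))"
      by (rule card_UN_le[OF N(1)])
    finally show ?thesis .
  qed
  then have "card ?Z * d \<le> (\<Sum>v\<in>?Z. \<Sum>u\<in>neighbourhood X v. card (f u))"
    using sum_bounded_below[of ?Z d] by simp
  also have "\<dots> \<le> (\<Sum>v\<in>?V. \<Sum>u\<in>neighbourhood X v. card (f u))"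
    by (rule sum_mono2) (use fin in auto)
  also have "\<dots> = (\<Sum>v\<in>?V. \<Sum>u | u \<in> ?V \<and> u \<in> neighbourhood X v. card (f u))"
    using N(2) by (intro sum.cong) auto
  also have "\<dots> = (\<Sum>u\<in>?V. \<Sum>v | v \<in> ?V \<and> u \<in> neighbourhood X v. card (f u))"
    by (rule sum.swap_restrict[OF fin fin])
  also have "\<dots> = (\<Sum>u\<in>?V. d * card (f u))"
  proof (rule sum.cong[OF refl])
    fix u assume u: "u \<in> ?V"
    \<comment> \<open>Symmetry of the arcs turns the vertices that see u into the neighbours of u,
      of which there are d.\<close>
    have "{v. v \<in> ?V \<and> u \<in> neighbourhood X v} = neighbourhood X u"
      using sym u N(2) by blast
    then show "(\<Sum>v | v \<in> ?V \<and> u \<in> neighbourhood X v. card (f u)) = d * card (f u)"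
      using reg u by (simp add: regular_graph_def)
  qed
  also have "\<dots> = rainbow_weight X f * d"
    by (simp add: rainbow_weight_def sum_distrib_left mult.commute)
  finally have empties: "card ?Z \<le> rainbow_weight X f" using d by simp
  have "card (?V - ?Z) = (\<Sum>v\<in>?V - ?Z. 1)" by simp
  also have "\<dots> \<le> (\<Sum>v\<in>?V - ?Z. card (f v))"
    by (rule sum_mono) (use finf in \<open>auto simp: Suc_le_eq card_gt_0_iff\<close>)
  also have "\<dots> \<le> rainbow_weight X f"
    unfolding rainbow_weight_def by (rule sum_mono2) (use fin in auto)
  finally have "card (?V - ?Z) \<le> rainbow_weight X f" .
  moreover have "card ?V = card ?Z + card (?V - ?Z)"
    using fin by (subst card_Un_disjoint[symmetric]) (auto intro: arg_cong[where f = card])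
  ultimately show ?thesis using empties by simp
qed

lemma rainbow_domination_regularI:
  assumes X: "pair_graph X" and reg: "regular_graph d X" and d: "d > 0"
    and f: "rainbow_dominating d X f" and wt: "2 * rainbow_weight X f = card (pverts X)"
  shows "rainbow_domination_regular d X"
proof -
  have "rainbow_domination_number d X = rainbow_weight X f"
    unfolding rainbow_domination_number_def
    using f wt card_pverts_le_double_weight[OF X reg d]
    by (intro Least_equality) (fastforce simp flip: wt)+
  then show ?thesis
    using reg wt by (simp add: rainbow_domination_regular_def flip: wt)
qed

text \<open>One colour on each vertex of \<open>V2\<close> and none on \<open>V1\<close> has weight
  \<open>card V2\<close>, which meets the lower bound. Only the vertices of \<open>V1\<close> are
  empty, so domination has to be checked only there.\<close>

lemma rainbow_domination_regular_colouring:
  assumes X: "pair_graph X" and reg: "regular_graph d X" and d: "d > 0"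
    and bip: "bipartition X V1 V2" and half: "2 * card V2 = card (pverts X)"
    and c: "\<And>w. w \<in> V2 \<Longrightarrow> c w \<in> {1..d}"
    and colours: "\<And>w. w \<in> V1 \<Longrightarrow> {1..d} \<subseteq> c ` (neighbourhood X w)"
  shows "rainbow_domination_regular d X"
proof (rule rainbow_domination_regularI[OF X reg d])
  interpret pair_graph X by (rule X)
  let ?f = "\<lambda>u. if u \<in> V2 then {c u} else {}"
  have V: "pverts X = V1 \<union> V2" "V1 \<inter> V2 = {}" using bip by (auto simp: bipartition_def)
  have N: "neighbourhood X w \<subseteq> V2" if "w \<in> V1" for w
    using bip that by (fastforce simp: bipartition_def neighbourhood_def)
  show "rainbow_dominating d X ?f"
    unfolding rainbow_dominating_def
  proof (intro conjI ballI impI)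
    fix w assume "w \<in> pverts X"
    show "?f w \<subseteq> {1..d}" using c by auto
    assume "?f w = {}"
    then have w: "w \<in> V1" using V \<open>w \<in> pverts X\<close> by (auto split: if_splits)
    have "(\<Union>u\<in>neighbourhood X w. ?f u) = c ` neighbourhood X w"
      using N[OF w] by auto
    also have "\<dots> = {1..d}"
      using colours[OF w] N[OF w] c by blast
    finally show "(\<Union>u\<in>neighbourhood X w. ?f u) = {1..d}" .
  qed
  have "finite (pverts X)" by (rule pair_finite_verts)
  moreover have "card (?f u) = (if u \<in> V2 then 1 else 0)" for u by simp
  moreover have "pverts X \<inter> V2 = V2" using V by auto
  ultimately have "rainbow_weight X ?f = card V2"
    by (simp only: rainbow_weight_def flip: sum.inter_restrict) simp
  then show "2 * rainbow_weight X ?f = card (pverts X)" using half by simp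
qed

section \<open>Automorphisms of connected bipartite graphs\<close>

text \<open>Every arc changes sides, and so does its image. Hence along a path from u to w the sides
  change equally often before and after applying g. The equivalence covers automorphisms that fix
  the sides and those that swap them.\<close>

lemma graph_aut_same_side:
  assumes X: "pair_graph X" and conn: "connected (with_proj X)" and bip: "bipartition X V1 V2"
    and g: "g \<in> graph_aut X" and u: "u \<in> pverts X" and w: "w \<in> pverts X"
  shows "(u \<in> V1 \<longleftrightarrow> w \<in> V1) \<longleftrightarrow> (g u \<in> V1 \<longleftrightarrow> g w \<in> V1)"
proof -
  interpret pair_graph X by (rule X)
  have flip: "x \<in> V1 \<longleftrightarrow> y \<notin> V1" if "(x, y) \<in> parcs X" for x y
    using bip that by (fastforce simp: bipartition_def)
  have "strongly_connected (with_proj X)"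
    using symmetric_connected_imp_strongly_connected[OF pair_sym_arcs conn] .
  then have "(u, w) \<in> rtrancl_on (pverts X) (parcs X)"
    using u w by (simp add: strongly_connected_def reachable_def)
  then show ?thesis
  proof (induction rule: rtrancl_on_induct)
    case base
    show ?case by simp
  next
    case (step y z)
    then have "(g y, g z) \<in> parcs X"
      using g by (auto simp: graph_aut_def)
    then show ?case using step flip[of y z] flip[of "g y" "g z"] by blast
  qed
qed

lemma graph_aut_neighbourhood:
  assumes g: "g \<in> graph_aut X" and u: "u \<in> pverts X"
  shows "neighbourhood X (g u) = g ` neighbourhood X u"
proof -
  have "g ` pverts X = pverts X" using g by (auto simp: graph_aut_def Bij_def bij_betw_def)
  then show ?thesis
    using g u by (auto simp: neighbourhood_def graph_aut_def image_iff) (metis imageE)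
qed

section \<open>Colouring one side by the translates of the block\<close>

theorem theorem3p4:
  fixes X :: "'a pair_pre_digraph" and V1 V2 B :: "'a set" and v :: 'a
    and G :: "('a \<Rightarrow> 'a) set" and n d :: nat
  assumes "pair_graph X" and "connected (with_proj X)" and "vertex_transitive X"
    and "card (pverts X) = n" and "regular_graph d X"
    and "bipartition X V1 V2"
    and "subgroup G (GraphAutGroup X)"
    and "transitive_action (GraphAutGroup X\<lparr>carrier := G\<rparr>) (pverts X) (\<lambda>g. g)"
    and "block (GraphAutGroup X\<lparr>carrier := G\<rparr>) (pverts X) (\<lambda>g. g) B"
    and "real (card B) = real n / (2 * real d)"
    and "B \<subseteq> V1"
    and "v \<in> B"
    and "card {C \<in> {g ` B | g. g \<in> G}. neighbourhood X v \<inter> C \<noteq> {}} = d"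
  shows "rainbow_domination_regular d X \<and>
    (\<exists>H. subgroup H (GraphAutGroup X\<lparr>carrier := G\<rparr>) \<and>
         (\<exists>w\<in>pverts X. B = Group_Action.orbit (GraphAutGroup X\<lparr>carrier := H\<rparr>) (\<lambda>g. g) w) \<and>
         [card H = 0] (mod (n div (2 * d))) \<and>
         stabilizer (GraphAutGroup X\<lparr>carrier := G\<rparr>) (\<lambda>g. g) v \<subseteq> H)"
proof -
  interpret pair_graph X by (rule assms(1))
  let ?V = "pverts X" and ?A = "GraphAutGroup X\<lparr>carrier := G\<rparr>"
  interpret A: transitive_action ?A ?V "\<lambda>g. g" by (rule assms(8))
  interpret A: group ?A using A.group_hom group_hom.axioms(1) by auto
  note bip = assms(6) and B = assms(9)
  have fin: "finite ?V" by (rule pair_finite_verts)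
  have V: "?V = V1 \<union> V2" "V1 \<inter> V2 = {}" using bip by (auto simp: bipartition_def)
  have BV: "B \<subseteq> ?V" and vV: "v \<in> ?V" using B assms(12) by (auto simp: block_def)
  have aut: "g \<in> graph_aut X" if "g \<in> G" for g
    using subgroup.subset[OF assms(7)] that by (auto simp: GraphAutGroup_def)
  have inj: "inj_on g ?V" and img: "g ` ?V = ?V" if "g \<in> G" for g
    using A.inj_prop[of g] A.surj_prop[of g] that by auto
  have same_side: "(u \<in> V1 \<longleftrightarrow> w \<in> V1) \<longleftrightarrow> (g u \<in> V1 \<longleftrightarrow> g w \<in> V1)"
    if "g \<in> G" "u \<in> ?V" "w \<in> ?V" for g u w
    by (rule graph_aut_same_side[OF assms(1,2) bip aut[OF that(1)] that(2,3)])
  have NV2: "neighbourhood X w \<subseteq> V2" if "w \<in> V1" for w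
    using bip that V(2) by (fastforce simp: bipartition_def neighbourhood_def)

  have card_B: "card B > 0"
    using assms(12) finite_subset[OF BV fin] by (auto simp: card_gt_0_iff)
  \<comment> \<open>Real division by zero yields 0, so d = 0 would make \<open>B\<close>
    empty.\<close>
  then have d: "d > 0" using assms(10) by (cases "d = 0") auto
  have n: "n = 2 * (d * card B)"
  proof -
    have "real n = real (2 * (d * card B))" using assms(10) d by (simp add: field_simps)
    then show ?thesis by (simp only: of_nat_eq_iff)
  qed

  have "neighbourhood X v \<noteq> {}" using assms(5) vV d by (auto simp: regular_graph_def)
  then obtain u where u: "u \<in> V2" using NV2 assms(11,12) by blast
  \<comment> \<open>Taking v to one of its neighbours, \<open>s\<close> must swap the two sides;
    this shows that they have the same size.\<close>
  then obtain s where s: "s \<in> G" "s v = u" using A.unique_orbit[of v u] vV V by auto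
  have swap: "s w \<in> V1 \<longleftrightarrow> w \<in> V2" if "w \<in> ?V" for w
    using same_side[OF s(1) vV that] assms(11,12) s(2) u V that by blast
  have "card V1 = card V2"
  proof (rule card_bij_eq)
    show "inj_on s V1" "inj_on s V2" using inj[OF s(1)] V by (auto intro: inj_on_subset)
    show "s ` V1 \<subseteq> V2" "s ` V2 \<subseteq> V1" using swap img[OF s(1)] V by blast+
    show "finite V1" "finite V2" using fin V by auto
  qed
  then have half: "2 * card V2 = card ?V"
    using fin V card_Un_disjoint[of V1 V2] by simp
  with n assms(4) have card_V2: "card V2 = d * card B" by simp

  \<comment> \<open>The members of \<open>D\<close> will be the colour classes.\<close>
  define D where "D = {C \<in> {g ` B | g. g \<in> G}. C \<subseteq> V2}"
  have D_cong: "C = C'" if "C \<in> D" "C' \<in> D" "C \<inter> C' \<noteq> {}" for C C'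
  proof -
    obtain g h where "g \<in> G" "C = g ` B" "h \<in> G" "C' = h ` B"
      using \<open>C \<in> D\<close> \<open>C' \<in> D\<close> by (auto simp: D_def)
    then show ?thesis
      using A.block_images_eq_or_disjoint[OF B, of g h] \<open>C \<inter> C' \<noteq> {}\<close> by simp
  qed
  \<comment> \<open>All of \<open>B\<close> lies in \<open>V1\<close>, so a translate lies on one
    side and a single point decides which.\<close>
  have translate_side: "g ` B \<subseteq> V2" if g: "g \<in> G" and "g b \<in> V2" "b \<in> B" for g b
  proof
    fix x assume "x \<in> g ` B"
    then obtain a where "a \<in> B" "x = g a" by blast
    then show "x \<in> V2"
      using same_side[OF g, of a b] that assms(11) BV img[OF g] V by blast
  qed
  have Union_D: "\<Union>D = V2"
  proof
    show "V2 \<subseteq> \<Union>D"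
    proof
      fix w assume w: "w \<in> V2"
      then obtain g where g: "g \<in> G" "g v = w" using A.unique_orbit[of v w] vV V by auto
      then have "g ` B \<in> D" "w \<in> g ` B"
        using translate_side[OF g(1), of v] w assms(12) by (auto simp: D_def)
      then show "w \<in> \<Union>D" by blast
    qed
  qed (auto simp: D_def)
  have finD: "finite D"
    using fin V by (intro finite_subset[of D "Pow V2"]) (auto simp: D_def)
  have "card B * card D = card (\<Union>D)"
  proof (rule card_partition[OF finD])
    show "finite (\<Union>D)" using Union_D fin V by simp
    show "card C = card B" if "C \<in> D" for C
      using that inj BV by (auto simp: D_def intro!: card_image intro: inj_on_subset)
  qed (use D_cong in blast)
  then have card_D: "card D = d" using Union_D card_V2 card_B by simp
  \<comment> \<open>The d translates met by the neighbourhood of v lie in \<open>V2\<close>, and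
    \<open>D\<close> has only d members, so none is missed.\<close>
  have "{C \<in> {g ` B | g. g \<in> G}. neighbourhood X v \<inter> C \<noteq> {}} = D"
  proof (rule card_subset_eq[OF finD])
    show "{C \<in> {g ` B | g. g \<in> G}. neighbourhood X v \<inter> C \<noteq> {}} \<subseteq> D"
      using NV2[of v] assms(11,12) translate_side by (fastforce simp: D_def)
  qed (use assms(13) card_D in simp)
  then have meets_v: "neighbourhood X v \<inter> C \<noteq> {}" if "C \<in> D" for C using that by blast
  have meets: "neighbourhood X w \<inter> C \<noteq> {}" if w: "w \<in> V1" and C: "C \<in> D" for w C
  proof -
    obtain g where g: "g \<in> G" "g v = w" using A.unique_orbit[of v w] vV w V by auto
    obtain h where h: "h \<in> G" "C = h ` B" and CV2: "C \<subseteq> V2" using C by (auto simp: D_def)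
    let ?k = "inv\<^bsub>?A\<^esub> g"
    have k: "?k \<in> G" using A.inv_closed[of g] g by simp
    have gk: "g (?k x) = x" if "x \<in> ?V" for x
      using A.orbit_sym_aux[of ?k x "?k x"] k g that by simp
    have kh: "?k \<otimes>\<^bsub>?A\<^esub> h \<in> G"
      using A.m_closed[of ?k h] k h(1) by simp
    have "(?k \<otimes>\<^bsub>?A\<^esub> h) ` B = ?k ` C"
      unfolding h(2) by (rule A.image_mult) (use k h(1) BV in simp_all)
    then have "?k ` C \<in> {g ` B | g. g \<in> G}" using kh by blast
    moreover have "?k x \<in> V2" if x: "x \<in> C" for x
    proof -
      have xV: "x \<in> ?V" "x \<notin> V1" using x CV2 V by auto
      then have kx: "?k x \<in> ?V" using img[OF k] by blast
      have "v \<in> V1" using assms(11,12) by auto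
      then show ?thesis
        using same_side[OF g(1) kx vV] gk[OF xV(1)] xV(2) w g(2) kx V(1) by simp
    qed
    ultimately have "?k ` C \<in> D" unfolding D_def by blast
    from meets_v[OF this] obtain x where x: "x \<in> C" "?k x \<in> neighbourhood X v" by blast
    then have "g (?k x) \<in> neighbourhood X w"
      using graph_aut_neighbourhood[OF aut[OF g(1)] vV] unfolding g(2) by simp
    moreover have "g (?k x) = x" using x(1) CV2 V(1) by (intro gk) auto
    ultimately have "x \<in> neighbourhood X w" by simp
    with x show ?thesis by blast
  qed

  \<comment> \<open>\<open>e\<close> numbers the blocks in \<open>V2\<close> by colours, and
    \<open>c\<close> gives each vertex the number of its block.\<close>
  obtain e where e: "bij_betw e {1..d} D"
    using ex_bij_betw_nat_finite_1[OF finD] card_D by blast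
  have "\<forall>w\<in>V2. \<exists>i\<in>{1..d}. w \<in> e i"
    using Union_D bij_betw_imp_surj_on[OF e] by blast
  then obtain c where c: "\<And>w. w \<in> V2 \<Longrightarrow> c w \<in> {1..d} \<and> w \<in> e (c w)" by metis
  have "rainbow_domination_regular d X"
  proof (rule rainbow_domination_regular_colouring[OF assms(1,5) d bip half])
    show "c w \<in> {1..d}" if "w \<in> V2" for w using c that by blast
    show "{1..d} \<subseteq> c ` neighbourhood X w" if w: "w \<in> V1" for w
    proof
      fix i assume i: "i \<in> {1..d}"
      then have ei: "e i \<in> D" by (rule bij_betw_apply[OF e])
      then obtain x where x: "x \<in> neighbourhood X w" "x \<in> e i" using meets[OF w] by blast
      then have cx: "c x \<in> {1..d}" "x \<in> e (c x)" using c NV2[OF w] by blast+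
      \<comment> \<open>The two blocks share x, so they coincide, and injectivity of
        \<open>e\<close> identifies the colours.\<close>
      then have "e (c x) = e i"
        using D_cong[OF bij_betw_apply[OF e cx(1)] ei] x(2) by blast
      then have "c x = i"
        using inj_onD[OF bij_betw_imp_inj_on[OF e] _ cx(1) i] by blast
      then show "i \<in> c ` neighbourhood X w" using x(1) by blast
    qed
  qed
  moreover
  let ?H = "{g \<in> G. g ` B = B}"
  have "subgroup ?H ?A" using A.subgroup_setwise_stabilizer[OF BV] by simp
  moreover have "B = Group_Action.orbit (GraphAutGroup X\<lparr>carrier := ?H\<rparr>) (\<lambda>g. g) v"
    using A.block_is_orbit[OF B assms(12)] by simp
  \<comment> \<open>The natural division is exact here, so the congruence is divisibility by the
    size of the block.\<close>
  moreover have "n div (2 * d) = card B" using n d by simp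
  then have "[card ?H = 0] (mod (n div (2 * d)))"
    using A.card_block_dvd_card_setwise_stabilizer[OF B] by (simp add: cong_0_iff)
  moreover have "stabilizer ?A (\<lambda>g. g) v \<subseteq> ?H"
    using A.stabilizer_subset_setwise_stabilizer[OF B assms(12)] by simp
  ultimately show ?thesis using vV by blast
qed

end
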